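(* Let $(\tau',\tau^\star,\tau^\circ,\tau^\natural)\in\mathbb{R}_{>0}\times\mathbb{R}_{>0}\times[0,\tau^\star]\times[0,\min\{\tau^\circ,\tau'\}]$, let $T'=(t'_k)_{k\in\mathbb{N}_0}$ and $T^\star=(t^\star_k)_{k\in\mathbb{N}_0}$ be admissible event sequences satisfying the bounds (B) given in the context, and let $\Delta$ be the corresponding operator defined in the context. Then for every $v\in\mathbf{L}_2$, $$\langle\Delta v,v\rangle_{\mathbf{L}_2}+\frac{\tau^\natural}{2}\|v\|_{\mathbf{L}_2}^2\ge0.$$
   Context: $\mathbb{N}_0$ denotes the non-negative integers. $\mathbf{L}_2$ is the space of square integrable functions $\mathbb{R}_{\ge 0}\to\mathbb{R}$ with usual inner product $\langle\cdot,\cdot\rangle_{\mathbf{L}_2}$ and norm $\|\cdot\|_{\mathbf{L}_2}$. $\mathbf{L}_{2e}$ is the set of functions $f:\mathbb{R}_{\ge0}\to\mathbb{R}$ whose truncation to $[0,\tau]$ (set to zero for $t>\tau$) is in $\mathbf{L}_2$ for every $\tau>0$. Admissible event sequence: $(t_k)_{k\in\mathbb{N}_0}\subset\mathbb{R}_{\ge0}$ with $t_0=0$, $t_{k+1}-t_k>0$ for all $k$, and $\lim_{k\to\infty}t_k=+\infty$. A sequence is also identified with its set of values. $T'=(t'_k)$ is the input sample event sequence and $T^\star=(t^\star_k)$ the output hold update event sequence. With $\phi_k=\min\{t : t\in T^\star\cap[t'_k,+\infty)\}$, the bounds (B) are, for all $k\in\mathbb{N}_0$: $0<t'_{k+1}-t'_k\le\tau'$;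 $0<t^\star_{k+1}-t^\star_k\le\tau^\star$; $\phi_k-t'_k\le\tau^\circ\le\tau^\star$; and $\phi_k-\max\{t : t\in T'\cap[0,\phi_k]\}\le\tau^\natural\le\min\{\tau^\circ,\tau'\}$. For $t\ge0$ let $n(t)=\max\{k\in\mathbb{N}_0 : t^\star_k\in[0,t]\}$, $p(t)=\max\{k\in\mathbb{N}_0 : t'_k\in[0,t]\}$, $q(t)=p(t^\star_{n(t)})$ and $\sigma''(t)=t-t'_{q(t)}$. Let $(\mathscr{R}_{\sigma''}v)(t)=v(t-\sigma''(t))$ (the argument equals $t'_{q(t)}\ge 0$), and let $(\mathscr{I}v)(t)=\int_0^t v(x)\,dx$. The operator $\Delta:\mathbf{L}_{2e}\to\mathbf{L}_{2e}$ is $\Delta=(\mathsf{id}-\mathscr{R}_{\sigma''})\mathscr{I}$, where $\mathsf{id}$ is the identity; i.e. $(\Delta v)(t)=(\mathscr{I}v)(t)-(\mathscr{I}v)(t'_{q(t)})$. *)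

theory Defs
  imports "HOL-Analysis.Analysis"
begin

text \<open>
  Signals on the half-line are functions on \<^typ>\<open>real\<close> of which only the values on
  \<open>{0..}\<close> matter. They are not identified up to null sets.
\<close>

definition L2 :: "(real \<Rightarrow> real) set" where
  "L2 = {f. set_borel_measurable lebesgue {0..} f \<and> set_integrable lebesgue {0..} (\<lambda>t. (f t)\<^sup>2)}"

definition L2_inner :: "(real \<Rightarrow> real) \<Rightarrow> (real \<Rightarrow> real) \<Rightarrow> real" where
  "L2_inner f g = (LINT t:{0..}|lebesgue. f t * g t)"

definition L2_norm :: "(real \<Rightarrow> real) \<Rightarrow> real" where
  "L2_norm f = sqrt (L2_inner f f)"

definition admissible :: "(nat \<Rightarrow> real) \<Rightarrow> bool" where
  "admissible s \<longleftrightarrow>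
     (\<forall>k. 0 \<le> s k) \<and> s 0 = 0 \<and> (\<forall>k. s (Suc k) - s k > 0) \<and> filterlim s at_top sequentially"

text \<open>
  Below, \<open>s\<close> is the input sample event sequence and \<open>h\<close> the output hold update event sequence.
  Admissibility guarantees that all the minima and maxima exist: the sets under \<^const>\<open>Max\<close> are
  finite and nonempty (for nonnegative times), and the set under \<^const>\<open>Least\<close>, although
  infinite, has a least element.
\<close>

definition next_hold :: "(nat \<Rightarrow> real) \<Rightarrow> (nat \<Rightarrow> real) \<Rightarrow> nat \<Rightarrow> real" where
  "next_hold s h k = (LEAST t. t \<in> range h \<inter> {s k..})"

definition timing_bounds ::
  "real \<Rightarrow> real \<Rightarrow> real \<Rightarrow> real \<Rightarrow> (nat \<Rightarrow> real) \<Rightarrow> (nat \<Rightarrow> real) \<Rightarrow> bool" where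
  "timing_bounds \<tau>s \<tau>h \<tau>c \<tau>n s h \<longleftrightarrow>
     (\<forall>k. 0 < s (Suc k) - s k \<and> s (Suc k) - s k \<le> \<tau>s \<and>
          0 < h (Suc k) - h k \<and> h (Suc k) - h k \<le> \<tau>h \<and>
          next_hold s h k - s k \<le> \<tau>c \<and> \<tau>c \<le> \<tau>h \<and>
          next_hold s h k - Max (range s \<inter> {0..next_hold s h k}) \<le> \<tau>n \<and> \<tau>n \<le> min \<tau>c \<tau>s)"

definition last_event :: "(nat \<Rightarrow> real) \<Rightarrow> real \<Rightarrow> nat" where
  "last_event s t = Max {k. s k \<in> {0..t}}"

definition held_sample :: "(nat \<Rightarrow> real) \<Rightarrow> (nat \<Rightarrow> real) \<Rightarrow> real \<Rightarrow> nat" where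
  "held_sample s h t = last_event s (h (last_event h t))"

definition sample_hold_delay :: "(nat \<Rightarrow> real) \<Rightarrow> (nat \<Rightarrow> real) \<Rightarrow> real \<Rightarrow> real" where
  "sample_hold_delay s h t = t - s (held_sample s h t)"

definition delay_op :: "(real \<Rightarrow> real) \<Rightarrow> (real \<Rightarrow> real) \<Rightarrow> real \<Rightarrow> real" where
  "delay_op \<sigma> v t = v (t - \<sigma> t)"

definition integral_op :: "(real \<Rightarrow> real) \<Rightarrow> real \<Rightarrow> real" where
  "integral_op v t = (LINT x:{0..t}|lebesgue. v x)"

definition Delta :: "(nat \<Rightarrow> real) \<Rightarrow> (nat \<Rightarrow> real) \<Rightarrow> (real \<Rightarrow> real) \<Rightarrow> real \<Rightarrow> real" where
  "Delta s h v t =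
     integral_op v t - delay_op (sample_hold_delay s h) (integral_op v) t"

end

theory Submission imports Defs begin

text \<open>
  On a hold interval \<open>[h n, h (n+1))\<close> the signal \<open>\<Delta> v\<close> is the primitive of \<open>v\<close> vanishing at the held
  sample time \<open>r n\<close>, so \<open>\<Delta> v \<cdot> v\<close> integrates there to the increment of \<open>(\<Delta> v)\<^sup>2 / 2\<close>. Summed over
  intervals with the same held sample the increments telescope; when a new sample is taken up at
  \<open>h (n+1)\<close>, the only loss is \<open>(\<integral> v)\<^sup>2 / 2\<close> over \<open>[r (n+1), h (n+1)]\<close>. These intervals are disjoint and
  of length at most \<open>\<tau>n\<close>, so by Cauchy-Schwarz the losses add up to at most \<open>\<tau>n / 2 \<cdot> \<parallel>v\<parallel>\<^sup>2\<close>.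
\<close>

section \<open>Fubini, primitives and Cauchy-Schwarz for the Lebesgue integral\<close>

lemma sigma_finite_completion:
  assumes "sigma_finite_measure M"
  shows "sigma_finite_measure (completion M)"
proof -
  obtain A where "countable A" "A \<subseteq> sets M" "\<Union>A = space M" "\<forall>a\<in>A. emeasure M a \<noteq> \<infinity>"
    using assms unfolding sigma_finite_measure_def by blast
  then have "countable A \<and> A \<subseteq> sets (completion M) \<and> \<Union>A = space (completion M) \<and>
      (\<forall>a\<in>A. emeasure (completion M) a \<noteq> \<infinity>)"
    by (auto simp: subset_eq)
  then show ?thesis
    unfolding sigma_finite_measure_def by blast
qed

text \<open>Signals are Lebesgue, not necessarily Borel, measurable. Fubini is therefore applied to
  products of \<open>lebesgue\<close>, the completion of \<open>lborel\<close>, and this requires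
  sigma-finiteness of the completed measure.\<close>

interpretation lebesgue: sigma_finite_measure "lebesgue :: 'a::euclidean_space measure"
  by (rule sigma_finite_completion) unfold_locales

interpretation lebesgue_pair: pair_sigma_finite
  "lebesgue :: 'a::euclidean_space measure" "lebesgue :: 'b::euclidean_space measure" ..

lemma lmeasurable_Ioc_Ico [simp]:
  "{a<..b :: real} \<in> lmeasurable" "{a..<b} \<in> lmeasurable"
  by (rule bounded_set_imp_lmeasurable; simp)+

text \<open>
  Integration by parts is not available for a merely integrable \<open>f\<close>; instead, by Fubini the
  integrals of \<open>f t * f x\<close> over \<open>x \<le> t\<close> and over \<open>x \<ge> t\<close> agree and add up to \<open>(\<integral> f)\<^sup>2\<close>.
\<close>

lemma integral_ordered_product_eq_half_square:
  fixes f :: "real \<Rightarrow> real"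
  assumes f: "integrable lebesgue f"
  shows "integrable lebesgue (\<lambda>t. f t * (LINT x:{..t}|lebesgue. f x))"
    and "(LINT t|lebesgue. f t * (LINT x:{..t}|lebesgue. f x)) = (LINT t|lebesgue. f t)\<^sup>2 / 2"
proof -
  have [measurable]: "f \<in> borel_measurable lebesgue"
    using f by auto
  \<comment> \<open>The identity from Lebesgue to Borel sets: with it the measurability prover can
    treat the two coordinates as real-valued functions and compare them in
    \<open>snd p \<le> fst p\<close>.\<close>
  have [measurable]: "(\<lambda>x::real. x) \<in> borel_measurable lebesgue"
    by (rule measurable_completion) simp
  have *: "integrable (lebesgue \<Otimes>\<^sub>M lebesgue) (\<lambda>(t, x). f t * f x)"
    by (rule lebesgue_pair.Fubini_integrable) (use f in \<open>auto simp: abs_mult\<close>)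
  have below: "integrable (lebesgue \<Otimes>\<^sub>M lebesgue)
      (\<lambda>(t, x). f t * (indicator {..t} x * f x))"
  proof (rule Bochner_Integration.integrable_bound[OF *])
    have "(\<lambda>p. f (fst p) * ((if snd p \<le> fst p then 1 else 0) * f (snd p)))
        \<in> borel_measurable (lebesgue \<Otimes>\<^sub>M lebesgue)"
      by measurable
    then show "(\<lambda>(t, x). f t * (indicator {..t} x * f x))
        \<in> borel_measurable (lebesgue \<Otimes>\<^sub>M lebesgue)"
      by (simp add: case_prod_beta' indicator_def of_bool_def)
  qed (auto simp: indicator_def)
  define I where "I = (LINT t|lebesgue. f t * (LINT x:{..t}|lebesgue. f x))"
  show int: "integrable lebesgue (\<lambda>t. f t * (LINT x:{..t}|lebesgue. f x))"
    using lebesgue_pair.integrable_fst[OF below] by (simp add: set_lebesgue_integral_def)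
  have I': "(LINT t|lebesgue. f t * (LINT x:{..t}|lebesgue. f x))
      = (LINT x|lebesgue. f x * (LINT t:{x..}|lebesgue. f t))"
  proof -
    have "(LINT t|lebesgue. f t * (LINT x:{..t}|lebesgue. f x))
        = (LINT t|lebesgue. LINT x|lebesgue. f t * (indicator {..t} x * f x))"
      by (simp add: set_lebesgue_integral_def)
    also have "\<dots> = (LINT x|lebesgue. LINT t|lebesgue. f t * (indicator {..t} x * f x))"
      using lebesgue_pair.Fubini_integral[OF below] by simp
    also have "\<dots> = (LINT x|lebesgue. LINT t|lebesgue. f x * (indicator {x..} t * f t))"
      by (intro Bochner_Integration.integral_cong refl) (auto simp: indicator_def)
    finally show ?thesis
      by (simp add: set_lebesgue_integral_def)
  qed
  have ge: "(LINT t:{x..}|lebesgue. f t) = (LINT t|lebesgue. f t) - (LINT t:{..x}|lebesgue. f t)" for x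
  proof -
    have sf: "set_integrable lebesgue A f" if "A \<in> sets lebesgue" for A
      using integrable_mult_indicator[OF that f] by (simp add: set_integrable_def)
    \<comment> \<open>The point \<open>x\<close> is a null set; removing it makes the two half-lines
      disjoint.\<close>
    have "(LINT t:{x..}|lebesgue. f t) = (LINT t:{x<..}|lebesgue. f t)"
      by (rule set_integral_discrete_difference[where X="{x}"]) auto
    moreover have "(LINT t:{..x} \<union> {x<..}|lebesgue. f t)
        = (LINT t:{..x}|lebesgue. f t) + (LINT t:{x<..}|lebesgue. f t)"
      by (rule set_integral_Un) (auto intro!: sf)
    moreover have "{..x} \<union> {x<..} = UNIV"
      by auto
    ultimately show ?thesis
      by (simp add: set_lebesgue_integral_def)
  qed
  have "I = (LINT x|lebesgue. f x * (LINT t|lebesgue. f t) - f x * (LINT t:{..x}|lebesgue. f t))"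
    unfolding I_def I' ge by (simp add: right_diff_distrib)
  also have "\<dots> = (LINT t|lebesgue. f t)\<^sup>2 - I"
    using f int by (simp add: I_def power2_eq_square)
  finally show "I = (LINT t|lebesgue. f t)\<^sup>2 / 2"
    by simp
qed

text \<open>Extending \<open>v\<close> by zero outside the interval reduces this to the whole line:
  for \<open>t\<close> inside, the extension has the same integral over \<open>{..t}\<close> as
  \<open>v\<close> over \<open>{a<..t}\<close>.\<close>

lemma set_integral_primitive_eq_half_square:
  fixes v :: "real \<Rightarrow> real"
  assumes v: "set_integrable lebesgue {a<..b} v"
  shows "set_integrable lebesgue {a<..b} (\<lambda>t. (LINT x:{a<..t}|lebesgue. v x) * v t)"
    and "(LINT t:{a<..b}|lebesgue. (LINT x:{a<..t}|lebesgue. v x) * v t)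
      = (LINT t:{a<..b}|lebesgue. v t)\<^sup>2 / 2"
proof -
  let ?f = "\<lambda>t. indicator {a<..b} t * v t"
  have f: "integrable lebesgue ?f"
    using v by (simp add: set_integrable_def)
  have eq: "indicator {a<..b} t *\<^sub>R ((LINT x:{a<..t}|lebesgue. v x) * v t)
      = ?f t * (LINT x:{..t}|lebesgue. ?f x)" for t
  proof (cases "t \<in> {a<..b}")
    case True
    then have "(LINT x:{a<..t}|lebesgue. v x) = (LINT x:{..t}|lebesgue. ?f x)"
      unfolding set_lebesgue_integral_def
      by (intro Bochner_Integration.integral_cong refl) (auto simp: indicator_def)
    with True show ?thesis
      by simp
  qed simp
  show "set_integrable lebesgue {a<..b} (\<lambda>t. (LINT x:{a<..t}|lebesgue. v x) * v t)"
    using integral_ordered_product_eq_half_square(1)[OF f]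
    unfolding set_integrable_def eq .
  show "(LINT t:{a<..b}|lebesgue. (LINT x:{a<..t}|lebesgue. v x) * v t)
      = (LINT t:{a<..b}|lebesgue. v t)\<^sup>2 / 2"
    using integral_ordered_product_eq_half_square(2)[OF f]
    unfolding set_lebesgue_integral_def[of lebesgue "{a<..b}"] eq by simp
qed

text \<open>The half-square formula on \<open>{a<..c}\<close> minus the one on
  \<open>{a<..b}\<close>. In the application \<open>a\<close> is a held sample time and
  \<open>b\<close>, \<open>c\<close> are consecutive hold times.\<close>

lemma set_integral_primitive_Ioc:
  fixes v :: "real \<Rightarrow> real"
  assumes v: "set_integrable lebesgue {a<..c} v" and "a \<le> b" "b \<le> c"
  shows "(LINT t:{b<..c}|lebesgue. (LINT x:{a<..t}|lebesgue. v x) * v t)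
      = (LINT t:{a<..c}|lebesgue. v t)\<^sup>2 / 2 - (LINT t:{a<..b}|lebesgue. v t)\<^sup>2 / 2"
proof -
  let ?g = "\<lambda>t. (LINT x:{a<..t}|lebesgue. v x) * v t"
  have vb: "set_integrable lebesgue {a<..b} v"
    using v by (rule set_integrable_subset) (use \<open>b \<le> c\<close> in auto)
  note g = set_integral_primitive_eq_half_square(1)[OF v]
  have "{a<..c} = {a<..b} \<union> {b<..c}"
    using assms by auto
  then have "(LINT t:{a<..c}|lebesgue. ?g t) = (LINT t:{a<..b}|lebesgue. ?g t) + (LINT t:{b<..c}|lebesgue. ?g t)"
    by (simp only:) (rule set_integral_Un; (rule set_integrable_subset[OF g])?; use assms in auto)
  then show ?thesis
    using set_integral_primitive_eq_half_square(2)[OF v] set_integral_primitive_eq_half_square(2)[OF vb]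
    by linarith
qed

text \<open>Nonnegativity of the variance: expand the integral of \<open>(v t - m)\<^sup>2\<close>,
  where \<open>m\<close> is the mean of \<open>v\<close> over the interval.\<close>

lemma Cauchy_Schwarz_set_integral_Ioc:
  fixes v :: "real \<Rightarrow> real"
  assumes v: "set_integrable lebesgue {a<..b} v"
    and v2: "set_integrable lebesgue {a<..b} (\<lambda>t. (v t)\<^sup>2)" and "a \<le> b"
  shows "(LINT t:{a<..b}|lebesgue. v t)\<^sup>2 \<le> (b - a) * (LINT t:{a<..b}|lebesgue. (v t)\<^sup>2)"
proof (cases "a = b")
  \<comment> \<open>The mean is meaningful only on an interval of positive length; here both sides
    are zero.\<close>
  case True
  then show ?thesis
    by (simp add: set_lebesgue_integral_def)
next
  case False
  define m where "m = (LINT t:{a<..b}|lebesgue. v t) / (b - a)"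
  let ?A = "LINT t:{a<..b}|lebesgue. (v t)\<^sup>2"
  have c: "set_integrable lebesgue {a<..b} (\<lambda>t. m\<^sup>2)"
    by (auto simp: set_integrable_def simp flip: lmeasurable_iff_integrable)
  have "0 \<le> (LINT t:{a<..b}|lebesgue. (v t - m)\<^sup>2)"
    unfolding set_lebesgue_integral_def by (intro integral_nonneg_AE) auto
  also have "(\<lambda>t. (v t - m)\<^sup>2) = (\<lambda>t. ((v t)\<^sup>2 - (2 * m) * v t) + m\<^sup>2)"
    by (auto simp: power2_eq_square algebra_simps)
  also have "(LINT t:{a<..b}|lebesgue. ((v t)\<^sup>2 - (2 * m) * v t) + m\<^sup>2)
      = ?A - 2 * m * (LINT t:{a<..b}|lebesgue. v t) + (LINT t:{a<..b}|lebesgue. m\<^sup>2)"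
    using v v2 c
    by (simp add: set_integral_add(2) set_integral_diff(2))
  also have "(LINT t:{a<..b}|lebesgue. m\<^sup>2) = m\<^sup>2 * (b - a)"
    using \<open>a \<le> b\<close> by (simp add: set_lebesgue_integral_def)
  also have "(LINT t:{a<..b}|lebesgue. v t) = m * (b - a)"
    using False by (simp add: m_def)
  finally have "m\<^sup>2 * (b - a) \<le> ?A"
    by (simp add: power2_eq_square algebra_simps)
  then have "(b - a) * (m\<^sup>2 * (b - a)) \<le> (b - a) * ?A"
    using \<open>a \<le> b\<close> by (intro mult_left_mono) auto
  moreover have "(LINT t:{a<..b}|lebesgue. v t)\<^sup>2 = (b - a) * (m\<^sup>2 * (b - a))"
    using False by (simp add: m_def power2_eq_square)
  ultimately show ?thesis
    by simp
qed

text \<open>By Fubini: a fixed \<open>x\<close> lies in the window of exactly those \<open>t\<close>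
  in \<open>{x..<x + d}\<close>, so \<open>\<bar>g x\<bar>\<close> is counted with a constant
  weight. Applied to the squared signal, this yields an integrable majorant of the square of
  \<Delta> v.\<close>

lemma integrable_moving_average:
  fixes g :: "real \<Rightarrow> real"
  assumes g: "integrable lebesgue g"
  shows "integrable lebesgue (\<lambda>t. LINT x:{t - d<..t}|lebesgue. g x)"
proof -
  have [measurable]: "g \<in> borel_measurable lebesgue"
    using g by auto
  have [measurable]: "(\<lambda>x::real. x) \<in> borel_measurable lebesgue"
    by (rule measurable_completion) simp
  let ?F = "\<lambda>(x, t). indicator {t - d<..t} x * g x"
  have m: "?F \<in> borel_measurable (lebesgue \<Otimes>\<^sub>M lebesgue)"
  proof -
    have "(\<lambda>p. (if snd p - d < fst p \<and> fst p \<le> snd p then 1 else 0) * g (fst p))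
        \<in> borel_measurable (lebesgue \<Otimes>\<^sub>M lebesgue)"
      by measurable
    then show ?thesis
      by (simp add: case_prod_beta' indicator_def of_bool_def)
  qed
  have eq: "norm (?F (x, t)) = indicator {x..<x + d} t * \<bar>g x\<bar>" for x t
    by (auto simp: indicator_def)
  have "integrable (lebesgue \<Otimes>\<^sub>M lebesgue) ?F"
  proof (rule lebesgue_pair.Fubini_integrable[OF m])
    have "(LINT t|lebesgue. norm (?F (x, t))) = measure lebesgue {x..<x + d} * \<bar>g x\<bar>" for x
      unfolding eq by simp
    \<comment> \<open>The maximum covers negative \<open>d\<close>, where every window is
      empty.\<close>
    moreover have "measure lebesgue {x..<x + d} = max 0 d" for x
      by (cases "0 \<le> d") auto
    ultimately have "(LINT t|lebesgue. norm (?F (x, t))) = max 0 d * \<bar>g x\<bar>" for x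
      by simp
    then show "integrable lebesgue (\<lambda>x. LINT t|lebesgue. norm (?F (x, t)))"
      using g by simp
    have "integrable lebesgue (\<lambda>t. indicator {x..<x + d} t * g x)" for x
      by (auto simp flip: lmeasurable_iff_integrable)
    moreover have "(\<lambda>t. ?F (x, t)) = (\<lambda>t. indicator {x..<x + d} t * g x)" for x
      by (intro ext) (auto simp: indicator_def)
    ultimately show "AE x in lebesgue. integrable lebesgue (\<lambda>t. ?F (x, t))"
      by simp
  qed
  from lebesgue_pair.integrable_snd[OF this] show ?thesis
    by (simp add: set_lebesgue_integral_def)
qed

section \<open>Event sequences and the age of the held sample\<close>

lemma admissible_strict_mono: "admissible s \<Longrightarrow> strict_mono s"
  by (simp add: admissible_def strict_mono_Suc_iff)

text \<open>Divergence of \<open>s\<close> gives a first index whose event lies after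
  \<open>t\<close>. It is not 0 because \<open>s 0 = 0\<close>, so its predecessor is the required
  index.\<close>

lemma admissible_ex_interval:
  assumes s: "admissible s" and "0 \<le> t"
  shows "\<exists>n. s n \<le> t \<and> t < s (Suc n)"
proof -
  have "eventually (\<lambda>n. t < s n) sequentially"
    using s by (simp add: admissible_def filterlim_at_top_dense)
  then obtain N where N: "t < s N"
    by (auto simp: eventually_sequentially)
  define m where "m = (LEAST n. t < s n)"
  have m: "t < s m"
    unfolding m_def by (rule LeastI[of _ N]) (rule N)
  moreover have "s 0 = 0"
    using s by (simp add: admissible_def)
  ultimately obtain n where n: "m = Suc n"
    using \<open>0 \<le> t\<close> by (cases m) auto
  have "\<not> t < s n"
    using not_less_Least[of n "\<lambda>n. t < s n"] n unfolding m_def by simp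
  with m n show ?thesis
    by (auto simp: not_less)
qed

lemma last_event_eqI:
  assumes s: "admissible s" and n: "s n \<le> t" "t < s (Suc n)"
  shows "last_event s t = n"
proof -
  have "s k \<le> t \<longleftrightarrow> k \<le> n" for k
  proof
    assume "s k \<le> t"
    then have "s k < s (Suc n)"
      using n by linarith
    then show "k \<le> n"
      using strict_mono_less[OF admissible_strict_mono[OF s]] by simp
  next
    assume "k \<le> n"
    then have "s k \<le> s n"
      using strict_mono_less_eq[OF admissible_strict_mono[OF s]] by simp
    then show "s k \<le> t"
      using n by linarith
  qed
  moreover have "0 \<le> s k" for k
    using s by (simp add: admissible_def)
  ultimately have "{k. s k \<in> {0..t}} = {..n}"
    by auto
  then show ?thesis
    by (simp add: last_event_def Max_eq_iff)
qed

lemma last_event_bounds: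
  assumes "admissible s" "0 \<le> t"
  shows "s (last_event s t) \<le> t" "t < s (Suc (last_event s t))"
  using admissible_ex_interval[OF assms] last_event_eqI[OF assms(1)] by auto

text \<open>Links the timing bounds, which take a maximum over event times, with the held sample,
  which is chosen by a maximum over indices.\<close>

lemma Max_range_eq_last_event:
  assumes s: "admissible s" and t: "0 \<le> t"
  shows "Max (range s \<inter> {0..t}) = s (last_event s t)"
proof (rule Max_eqI)
  note b = last_event_bounds[OF s t]
  have le: "s k \<le> t \<Longrightarrow> k \<le> last_event s t" for k
    using b(2) strict_mono_less[OF admissible_strict_mono[OF s], of k "Suc (last_event s t)"] by simp
  then have "range s \<inter> {0..t} \<subseteq> s ` {..last_event s t}"
    by auto
  then show "finite (range s \<inter> {0..t})"
    by (rule finite_subset) simp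
  show "y \<le> s (last_event s t)" if "y \<in> range s \<inter> {0..t}" for y
    using that le strict_mono_less_eq[OF admissible_strict_mono[OF s]] by auto
  show "s (last_event s t) \<in> range s \<inter> {0..t}"
    using b s by (auto simp: admissible_def)
qed

lemma next_hold_eqI:
  assumes h: "admissible h" and "h n < s k" "s k \<le> h (Suc n)"
  shows "next_hold s h k = h (Suc n)"
  unfolding next_hold_def
proof (rule Least_equality)
  show "h (Suc n) \<in> range h \<inter> {s k..}"
    using assms by auto
  fix y assume "y \<in> range h \<inter> {s k..}"
  then obtain m where m: "y = h m" "s k \<le> h m"
    by auto
  then have "h n < h m"
    using assms by linarith
  then show "h (Suc n) \<le> y"
    using strict_mono_less[OF admissible_strict_mono[OF h]]
      strict_mono_less_eq[OF admissible_strict_mono[OF h]] m by (simp add: Suc_le_eq)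
qed

text \<open>A newly adopted sample was taken after \<open>h n\<close>, so \<open>h (Suc n)\<close>
  is the first hold update at or after it. The last timing bound then limits its age by
  \<open>\<tau>n\<close>.\<close>

lemma held_sample_step:
  assumes s: "admissible s" and h: "admissible h" and b: "timing_bounds \<tau>s \<tau>h \<tau>c \<tau>n s h"
    and new: "last_event s (h (Suc n)) \<noteq> last_event s (h n)"
  shows "h n < s (last_event s (h (Suc n)))"
    and "h (Suc n) - s (last_event s (h (Suc n))) \<le> \<tau>n"
proof -
  define k where "k = last_event s (h (Suc n))"
  have h0: "0 \<le> h i" for i
    using h by (simp add: admissible_def)
  have k: "s k \<le> h (Suc n)" "h (Suc n) < s (Suc k)"
    unfolding k_def using last_event_bounds[OF s h0] by auto
  have "h n < h (Suc n)"
    using h by (simp add: admissible_def)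
  \<comment> \<open>Otherwise \<open>s k \<le> h n < s (Suc k)\<close>, and sample \<open>k\<close>
    would already be the latest one at \<open>h n\<close>.\<close>
  then have *: "h n < s k"
    using k new last_event_eqI[OF s, of k "h n"] by (fastforce simp: k_def)
  then show "h n < s (last_event s (h (Suc n)))"
    by (simp add: k_def)
  have "h (Suc n) - Max (range s \<inter> {0..h (Suc n)}) \<le> \<tau>n"
    using b unfolding next_hold_eqI[of h n s k, OF h * k(1), symmetric] timing_bounds_def by blast
  then show "h (Suc n) - s (last_event s (h (Suc n))) \<le> \<tau>n"
    by (simp add: Max_range_eq_last_event[OF s h0])
qed

section \<open>Measurability and integrability of signals\<close>

text \<open>Stated for measurable \<open>f\<close> because an L2 signal may fail to be integrable
  over the whole half-line.\<close>

lemma borel_measurable_indefinite_integral: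
  fixes f :: "real \<Rightarrow> real"
  assumes [measurable]: "f \<in> borel_measurable lebesgue"
  shows "(\<lambda>t. LINT x:{..t}|lebesgue. f x) \<in> borel_measurable lebesgue"
proof -
  have [measurable]: "(\<lambda>x::real. x) \<in> borel_measurable lebesgue"
    by (rule measurable_completion) simp
  have "(\<lambda>p. (if snd p \<le> fst p then 1 else 0) * f (snd p))
      \<in> borel_measurable (lebesgue \<Otimes>\<^sub>M lebesgue)"
    by measurable
  then have "(\<lambda>(t, x). indicator {..t} x * f x) \<in> borel_measurable (lebesgue \<Otimes>\<^sub>M lebesgue)"
    by (simp add: case_prod_beta' indicator_def of_bool_def)
  from lebesgue.borel_measurable_lebesgue_integral[OF this] show ?thesis
    by (simp add: set_lebesgue_integral_def)
qed

text \<open>The product is dominated by the sum of the squares. Its measurability comes from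
  multiplying the two restrictions to \<open>{0..}\<close>, since nothing is known about signals at
  negative times.\<close>

lemma L2_mult_set_integrable:
  assumes "f \<in> L2" "g \<in> L2"
  shows "set_integrable lebesgue {0..} (\<lambda>t. f t * g t)"
proof (rule set_integrable_bound)
  show "set_integrable lebesgue {0..} (\<lambda>t. (f t)\<^sup>2 + (g t)\<^sup>2)"
    using assms by (intro set_integral_add) (auto simp: L2_def)
  have "(\<lambda>t. (indicator {0..} t *\<^sub>R f t) * (indicator {0..} t *\<^sub>R g t)) \<in> borel_measurable lebesgue"
    using assms by (intro borel_measurable_times) (auto simp: L2_def set_borel_measurable_def)
  also have "(\<lambda>t. (indicator {0..} t *\<^sub>R f t) * (indicator {0..} t *\<^sub>R g t))
      = (\<lambda>t. indicator {0..} t *\<^sub>R (f t * g t))"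
    by (auto simp: indicator_def)
  finally show "set_borel_measurable lebesgue {0..} (\<lambda>t. f t * g t)"
    by (simp add: set_borel_measurable_def)
  have "\<bar>a * b\<bar> \<le> a\<^sup>2 + b\<^sup>2" for a b :: real
    using sum_squares_bound[of "\<bar>a\<bar>" "\<bar>b\<bar>"] abs_ge_zero[of "a * b"]
    unfolding abs_mult power2_abs mult.assoc by linarith
  then show "AE t in lebesgue. t \<in> {0..} \<longrightarrow> norm (f t * g t) \<le> norm ((f t)\<^sup>2 + (g t)\<^sup>2)"
    by simp
qed

text \<open>On a set of finite measure \<open>1 + (v t)\<^sup>2\<close> is an integrable majorant of
  \<open>\<bar>v t\<bar>\<close>.\<close>

lemma L2_set_integrable:
  assumes v: "v \<in> L2" and A: "A \<in> lmeasurable" "A \<subseteq> {0..}"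
  shows "set_integrable lebesgue A v"
proof (rule set_integrable_bound)
  have "set_integrable lebesgue A (\<lambda>t. (v t)\<^sup>2)"
    using v by (intro set_integrable_subset[OF _ fmeasurableD[OF A(1)] A(2)]) (auto simp: L2_def)
  moreover have "set_integrable lebesgue A (\<lambda>t. 1 :: real)"
    using A by (simp add: set_integrable_def flip: lmeasurable_iff_integrable)
  ultimately show "set_integrable lebesgue A (\<lambda>t. 1 + (v t)\<^sup>2)"
    by (intro set_integral_add)
  show "set_borel_measurable lebesgue A v"
    using v by (intro set_borel_measurable_subset[OF _ fmeasurableD[OF A(1)] A(2)]) (auto simp: L2_def)
  have "\<bar>a\<bar> \<le> 1 + a\<^sup>2" for a :: real
    using zero_le_power2[of "\<bar>a\<bar> - 1"] zero_le_power2[of a]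
    by (simp add: power2_diff)
  then show "AE t in lebesgue. t \<in> A \<longrightarrow> norm (v t) \<le> norm (1 + (v t)\<^sup>2)"
    by simp
qed

lemma L2_set_integrable_Ioc:
  assumes "v \<in> L2" "0 \<le> a"
  shows "set_integrable lebesgue {a<..b} v"
    and "set_integrable lebesgue {a<..b} (\<lambda>t. (v t)\<^sup>2)"
proof -
  show "set_integrable lebesgue {a<..b} v"
    using assms by (intro L2_set_integrable) auto
  show "set_integrable lebesgue {a<..b} (\<lambda>t. (v t)\<^sup>2)"
    using assms by (auto simp: L2_def intro: set_integrable_subset[of lebesgue "{0..}"])
qed

section \<open>The operator \<Delta> as a piecewise primitive, and its square integrability\<close>

lemma integral_op_diff:
  assumes v: "v \<in> L2" and "0 \<le> r" "r \<le> t"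
  shows "integral_op v t - integral_op v r = (LINT x:{r<..t}|lebesgue. v x)"
proof -
  have "{0..t} = {0..r} \<union> {r<..t}"
    using assms by auto
  moreover have "(LINT x:{0..r} \<union> {r<..t}|lebesgue. v x)
      = (LINT x:{0..r}|lebesgue. v x) + (LINT x:{r<..t}|lebesgue. v x)"
    using assms by (intro set_integral_Un L2_set_integrable) auto
  ultimately show ?thesis
    by (simp add: integral_op_def)
qed

text \<open>The held sample is constant on a hold interval. The first form separates off a constant
  and serves measurability; the second serves the estimates.\<close>

lemma Delta_eq:
  assumes s: "admissible s" and h: "admissible h" and v: "v \<in> L2"
    and t: "h n \<le> t" "t < h (Suc n)"
  shows "Delta s h v t = integral_op v t - integral_op v (s (last_event s (h n)))"
    and "Delta s h v t = (LINT x:{s (last_event s (h n))<..t}|lebesgue. v x)"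
proof -
  show *: "Delta s h v t = integral_op v t - integral_op v (s (last_event s (h n)))"
    using last_event_eqI[OF h t]
    by (simp add: Delta_def delay_op_def sample_hold_delay_def held_sample_def)
  have "0 \<le> h n" "0 \<le> s (last_event s (h n))"
    using s h by (auto simp: admissible_def)
  then show "Delta s h v t = (LINT x:{s (last_event s (h n))<..t}|lebesgue. v x)"
    unfolding * using t last_event_bounds(1)[OF s, of "h n"] by (intro integral_op_diff[OF v]) auto
qed

lemma set_borel_measurable_Delta:
  assumes s: "admissible s" and h: "admissible h" and v: "v \<in> L2"
  shows "set_borel_measurable lebesgue {0..} (Delta s h v)"
  unfolding set_borel_measurable_def
proof (rule measurable_piecewise_restrict2)
  \<comment> \<open>Index 0 holds the negative half-line, where the indicator makes the function
    zero, so hold interval \<open>n\<close> gets index \<open>Suc n\<close>.\<close>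
  let ?A = "\<lambda>n. case n of 0 \<Rightarrow> {..<0} | Suc n \<Rightarrow> {h n..<h (Suc n)}"
  have "(\<lambda>t. LINT x:{..t}|lebesgue. indicator {0..} x *\<^sub>R v x) \<in> borel_measurable lebesgue"
    using v by (intro borel_measurable_indefinite_integral) (auto simp: L2_def set_borel_measurable_def)
  also have "(\<lambda>t. LINT x:{..t}|lebesgue. indicator {0..} x *\<^sub>R v x) = integral_op v"
    unfolding integral_op_def set_lebesgue_integral_def
    by (intro ext Bochner_Integration.integral_cong refl) (auto simp: indicator_def)
  finally have [measurable]: "integral_op v \<in> borel_measurable lebesgue" .
  show "?A n \<in> sets lebesgue" for n
    by (cases n) auto
  have "\<exists>n. t \<in> ?A n" for t
  proof (cases "t < 0")
    case True
    then show ?thesis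
      by (intro exI[of _ 0]) simp
  next
    case False
    then obtain n where "h n \<le> t \<and> t < h (Suc n)"
      using admissible_ex_interval[OF h] by (auto simp: not_less)
    then show ?thesis
      by (intro exI[of _ "Suc n"]) simp
  qed
  then show "space lebesgue = (\<Union>n. ?A n)"
    by auto
  show "\<exists>g\<in>borel_measurable lebesgue. \<forall>t\<in>?A n. indicator {0..} t *\<^sub>R Delta s h v t = g t" for n
  proof (cases n)
    case 0
    then show ?thesis
      by (intro bexI[of _ "\<lambda>_. 0"]) auto
  next
    case (Suc m)
    have "0 \<le> h m"
      using h by (simp add: admissible_def)
    then have "\<forall>t\<in>?A n. indicator {0..} t *\<^sub>R Delta s h v t
        = integral_op v t - integral_op v (s (last_event s (h m)))"
      using Delta_eq(1)[OF s h v] Suc by auto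
    then show ?thesis
      by (intro bexI[of _ "\<lambda>t. integral_op v t - integral_op v (s (last_event s (h m)))"]) auto
  qed
qed

text \<open>The held sample time \<open>r\<close> lags \<open>t\<close> by at most
  \<open>\<tau>s + \<tau>h\<close>, so after Cauchy-Schwarz the interval \<open>{r<..t}\<close> can
  be enlarged to a window of fixed length. This window may reach below 0, hence the
  indicator.\<close>

lemma Delta_power2_le:
  assumes s: "admissible s" and h: "admissible h" and b: "timing_bounds \<tau>s \<tau>h \<tau>c \<tau>n s h"
    and v: "v \<in> L2" and t: "0 \<le> t"
  shows "(Delta s h v t)\<^sup>2
    \<le> (\<tau>s + \<tau>h) * (LINT x:{t - (\<tau>s + \<tau>h)<..t}|lebesgue. indicator {0..} x *\<^sub>R (v x)\<^sup>2)"
proof -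
  let ?D = "\<tau>s + \<tau>h"
  obtain n where n: "h n \<le> t" "t < h (Suc n)"
    using admissible_ex_interval[OF h t] by blast
  define r where "r = s (last_event s (h n))"
  have hn: "0 \<le> h n" and r0: "0 \<le> r"
    using s h by (auto simp: admissible_def r_def)
  have r: "r \<le> h n" "h n < s (Suc (last_event s (h n)))"
    unfolding r_def using last_event_bounds[OF s hn] by auto
  have "s (Suc (last_event s (h n))) - r \<le> \<tau>s" "h (Suc n) - h n \<le> \<tau>h"
    using b by (auto simp: timing_bounds_def r_def)
  \<comment> \<open>The next sample comes after \<open>h n\<close> and within \<open>\<tau>s\<close>
    of \<open>r\<close>, so \<open>h n - r\<close> is below \<open>\<tau>s\<close>; and
    \<open>t - h n\<close> is below \<open>\<tau>h\<close>.\<close>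
  then have D: "t - r \<le> ?D"
    using r n by linarith
  have rt: "r \<le> t"
    using r n by simp
  have g: "integrable lebesgue (\<lambda>x. indicator {0..} x *\<^sub>R (v x)\<^sup>2)"
    using v by (simp add: L2_def set_integrable_def)
  have nonneg: "0 \<le> (LINT x:{r<..t}|lebesgue. (v x)\<^sup>2)"
    unfolding set_lebesgue_integral_def by (intro integral_nonneg_AE) auto
  have "(Delta s h v t)\<^sup>2 = (LINT x:{r<..t}|lebesgue. v x)\<^sup>2"
    unfolding Delta_eq(2)[OF s h v n] r_def ..
  also have "\<dots> \<le> (t - r) * (LINT x:{r<..t}|lebesgue. (v x)\<^sup>2)"
    by (intro Cauchy_Schwarz_set_integral_Ioc L2_set_integrable_Ioc v r0 rt)
  also have "\<dots> \<le> ?D * (LINT x:{r<..t}|lebesgue. (v x)\<^sup>2)"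
    using D nonneg by (rule mult_right_mono)
  also have "\<dots> \<le> ?D * (LINT x:{t - ?D<..t}|lebesgue. indicator {0..} x *\<^sub>R (v x)\<^sup>2)"
  proof (rule mult_left_mono)
    show "0 \<le> ?D"
      using D rt by linarith
    show "(LINT x:{r<..t}|lebesgue. (v x)\<^sup>2)
        \<le> (LINT x:{t - ?D<..t}|lebesgue. indicator {0..} x *\<^sub>R (v x)\<^sup>2)"
      unfolding set_lebesgue_integral_def
    proof (rule integral_mono)
      show "integrable lebesgue (\<lambda>x. indicator {r<..t} x *\<^sub>R (v x)\<^sup>2)"
        using L2_set_integrable_Ioc(2)[OF v r0] by (simp add: set_integrable_def)
      show "integrable lebesgue (\<lambda>x. indicator {t - ?D<..t} x *\<^sub>R indicator {0..} x *\<^sub>R (v x)\<^sup>2)"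
        by (intro integrable_mult_indicator g) auto
    qed (use D r0 in \<open>auto simp: indicator_def\<close>)
  qed
  finally show ?thesis .
qed

lemma Delta_L2:
  assumes s: "admissible s" and h: "admissible h" and b: "timing_bounds \<tau>s \<tau>h \<tau>c \<tau>n s h"
    and v: "v \<in> L2"
  shows "Delta s h v \<in> L2"
proof -
  let ?M = "\<lambda>t. (\<tau>s + \<tau>h) *
    (LINT x:{t - (\<tau>s + \<tau>h)<..t}|lebesgue. indicator {0..} x *\<^sub>R (v x)\<^sup>2)"
  note m = set_borel_measurable_Delta[OF s h v]
  have "integrable lebesgue ?M"
    using v by (intro integrable_mult_right integrable_moving_average) (simp add: L2_def set_integrable_def)
  then have "set_integrable lebesgue {0..} ?M"
    unfolding set_integrable_def by (intro integrable_mult_indicator) auto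
  moreover have "set_borel_measurable lebesgue {0..} (\<lambda>t. (Delta s h v t)\<^sup>2)"
  proof -
    have "(\<lambda>t. (indicator {0..} t *\<^sub>R Delta s h v t)\<^sup>2) \<in> borel_measurable lebesgue"
      using m by (intro borel_measurable_power) (simp add: set_borel_measurable_def)
    also have "(\<lambda>t. (indicator {0..} t *\<^sub>R Delta s h v t)\<^sup>2)
        = (\<lambda>t. indicator {0..} t *\<^sub>R (Delta s h v t)\<^sup>2)"
      by (auto simp: indicator_def)
    finally show ?thesis
      by (simp add: set_borel_measurable_def)
  qed
  moreover have "norm ((Delta s h v t)\<^sup>2) \<le> norm (?M t)" if "t \<in> {0..}" for t
    using Delta_power2_le[OF s h b v, of t] that by (simp del: real_scaleR_def)
  ultimately have "set_integrable lebesgue {0..} (\<lambda>t. (Delta s h v t)\<^sup>2)"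
    by (blast intro: set_integrable_bound AE_I2)
  with m show ?thesis
    by (simp add: L2_def)
qed

section \<open>Energy balance over the hold intervals\<close>

lemma Delta_inner_hold_interval:
  assumes s: "admissible s" and h: "admissible h" and v: "v \<in> L2"
  defines "r \<equiv> \<lambda>n. s (last_event s (h n))"
  shows "(LINT t:{h n..<h (Suc n)}|lebesgue. Delta s h v t * v t)
    = (LINT x:{r n<..h (Suc n)}|lebesgue. v x)\<^sup>2 / 2 - (LINT x:{r n<..h n}|lebesgue. v x)\<^sup>2 / 2"
proof -
  have "0 \<le> r n" "0 \<le> h n" "h n < h (Suc n)"
    using s h by (auto simp: admissible_def r_def)
  moreover have "r n \<le> h n"
    unfolding r_def by (rule last_event_bounds(1)[OF s]) fact
  moreover have "(LINT t:{h n..<h (Suc n)}|lebesgue. Delta s h v t * v t)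
      = (LINT t:{h n..<h (Suc n)}|lebesgue. (LINT x:{r n<..t}|lebesgue. v x) * v t)"
    using Delta_eq(2)[OF s h v] by (intro set_lebesgue_integral_cong) (auto simp: r_def)
  \<comment> \<open>The two half-open intervals differ only in their endpoints, a null set.\<close>
  moreover have "\<dots> = (LINT t:{h n<..h (Suc n)}|lebesgue. (LINT x:{r n<..t}|lebesgue. v x) * v t)"
    by (rule set_integral_discrete_difference[where X="{h n, h (Suc n)}"]) auto
  ultimately show ?thesis
    by (simp add: set_integral_primitive_Ioc L2_set_integrable_Ioc[OF v])
qed

text \<open>The square on the left is kept in the induction because it pays for the square
  subtracted on the next hold interval. The energy runs only up to \<open>h n\<close>, since the
  last sample change before \<open>h (Suc n)\<close> occurs at \<open>h n\<close> or
  earlier.\<close>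

lemma Delta_inner_lower_bound:
  assumes s: "admissible s" and h: "admissible h" and b: "timing_bounds \<tau>s \<tau>h \<tau>c \<tau>n s h"
    and v: "v \<in> L2" and "0 \<le> \<tau>n"
  defines "r \<equiv> \<lambda>n. s (last_event s (h n))"
  shows "(LINT x:{r n<..h (Suc n)}|lebesgue. v x)\<^sup>2 / 2
      - \<tau>n / 2 * (LINT x:{0<..h n}|lebesgue. (v x)\<^sup>2)
    \<le> (LINT t:{0..<h (Suc n)}|lebesgue. Delta s h v t * v t)"
proof (induction n)
  have h0: "h 0 = 0" and hpos: "0 \<le> h n" and rpos: "0 \<le> r n" for n
    using s h by (auto simp: admissible_def r_def)
  have J: "(LINT t:{h n..<h (Suc n)}|lebesgue. Delta s h v t * v t)
    = (LINT x:{r n<..h (Suc n)}|lebesgue. v x)\<^sup>2 / 2 - (LINT x:{r n<..h n}|lebesgue. v x)\<^sup>2 / 2" for n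
    unfolding r_def by (rule Delta_inner_hold_interval[OF s h v])
  {
    case 0
    \<comment> \<open>Since \<open>r 0 = h 0 = 0\<close>, the subtracted square is over an empty
      interval.\<close>
    have "r 0 \<le> h 0"
      unfolding r_def by (rule last_event_bounds(1)[OF s]) (simp add: h0)
    with rpos[of 0] have "r 0 = 0"
      by (simp add: h0)
    then show ?case
      using J[of 0] by (simp add: h0 set_lebesgue_integral_def)
  next
    case (Suc n)
    let ?E = "\<lambda>n. LINT x:{0<..h n}|lebesgue. (v x)\<^sup>2"
    have less: "h n < h (Suc n)" "h (Suc n) < h (Suc (Suc n))"
      using h by (auto simp: admissible_def)
    have "{0..<h (Suc (Suc n))} = {0..<h (Suc n)} \<union> {h (Suc n)..<h (Suc (Suc n))}"
      using less hpos[of "Suc n"] by auto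
    moreover have "(LINT t:{0..<h (Suc n)} \<union> {h (Suc n)..<h (Suc (Suc n))}|lebesgue. Delta s h v t * v t)
        = (LINT t:{0..<h (Suc n)}|lebesgue. Delta s h v t * v t)
          + (LINT t:{h (Suc n)..<h (Suc (Suc n))}|lebesgue. Delta s h v t * v t)"
      using hpos[of "Suc n"]
      by (intro set_integral_Un
          set_integrable_subset[OF L2_mult_set_integrable[OF Delta_L2[OF s h b v] v]]) auto
    ultimately have S: "(LINT t:{0..<h (Suc (Suc n))}|lebesgue. Delta s h v t * v t)
        \<ge> (LINT x:{r n<..h (Suc n)}|lebesgue. v x)\<^sup>2 / 2 - \<tau>n / 2 * ?E n
          + (LINT x:{r (Suc n)<..h (Suc (Suc n))}|lebesgue. v x)\<^sup>2 / 2
          - (LINT x:{r (Suc n)<..h (Suc n)}|lebesgue. v x)\<^sup>2 / 2"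
      using Suc.IH J[of "Suc n"] by simp
    have E: "?E (Suc n) = ?E n + (LINT x:{h n<..h (Suc n)}|lebesgue. (v x)\<^sup>2)"
    proof -
      have "{0<..h (Suc n)} = {0<..h n} \<union> {h n<..h (Suc n)}"
        using less hpos[of n] by auto
      then show ?thesis
        by (simp only:) (rule set_integral_Un; (rule L2_set_integrable_Ioc[OF v])?; use hpos in auto)
    qed
    have nonneg: "0 \<le> (LINT x:{h n<..h (Suc n)}|lebesgue. (v x)\<^sup>2)"
      unfolding set_lebesgue_integral_def by (intro integral_nonneg_AE) auto
    \<comment> \<open>If the held sample is unchanged, the two squares coincide. Otherwise the new
      sample was taken after \<open>h n\<close>, so the loss is charged to the energy of
      \<open>{h n<..h (Suc n)}\<close> alone and no energy is charged twice.\<close>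
    have "(LINT x:{r (Suc n)<..h (Suc n)}|lebesgue. v x)\<^sup>2
        \<le> (LINT x:{r n<..h (Suc n)}|lebesgue. v x)\<^sup>2
          + \<tau>n * (LINT x:{h n<..h (Suc n)}|lebesgue. (v x)\<^sup>2)"
    proof (cases "last_event s (h (Suc n)) = last_event s (h n)")
      case True
      then show ?thesis
        using nonneg \<open>0 \<le> \<tau>n\<close> by (simp add: r_def)
    next
      case False
      have r: "h n < r (Suc n)" "h (Suc n) - r (Suc n) \<le> \<tau>n"
        using held_sample_step[OF s h b False] by (auto simp: r_def)
      have r': "r (Suc n) \<le> h (Suc n)"
        unfolding r_def by (rule last_event_bounds(1)[OF s hpos])
      have nonneg': "0 \<le> (LINT x:{r (Suc n)<..h (Suc n)}|lebesgue. (v x)\<^sup>2)"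
        unfolding set_lebesgue_integral_def by (intro integral_nonneg_AE) auto
      have "(LINT x:{r (Suc n)<..h (Suc n)}|lebesgue. v x)\<^sup>2
          \<le> (h (Suc n) - r (Suc n)) * (LINT x:{r (Suc n)<..h (Suc n)}|lebesgue. (v x)\<^sup>2)"
        by (intro Cauchy_Schwarz_set_integral_Ioc L2_set_integrable_Ioc v rpos r')
      also have "\<dots> \<le> \<tau>n * (LINT x:{r (Suc n)<..h (Suc n)}|lebesgue. (v x)\<^sup>2)"
        using r(2) nonneg' by (rule mult_right_mono)
      also have "\<dots> \<le> \<tau>n * (LINT x:{h n<..h (Suc n)}|lebesgue. (v x)\<^sup>2)"
      proof (rule mult_left_mono[OF _ \<open>0 \<le> \<tau>n\<close>])
        show "(LINT x:{r (Suc n)<..h (Suc n)}|lebesgue. (v x)\<^sup>2)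
            \<le> (LINT x:{h n<..h (Suc n)}|lebesgue. (v x)\<^sup>2)"
          unfolding set_lebesgue_integral_def
          using L2_set_integrable_Ioc(2)[OF v rpos] L2_set_integrable_Ioc(2)[OF v hpos] r(1)
          by (intro integral_mono) (auto simp: set_integrable_def indicator_def)
      qed
      finally show ?thesis
        using zero_le_power2[of "LINT x:{r n<..h (Suc n)}|lebesgue. v x"]
        by linarith
    qed
    then have "(LINT x:{r (Suc n)<..h (Suc n)}|lebesgue. v x)\<^sup>2 / 2 + \<tau>n / 2 * ?E n
        \<le> (LINT x:{r n<..h (Suc n)}|lebesgue. v x)\<^sup>2 / 2 + \<tau>n / 2 * ?E (Suc n)"
      unfolding E by (simp add: algebra_simps)
    with S show ?case
      by linarith
  }
qed

text \<open>The intervals up to the hold times exhaust the half-line, and the product is integrable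
  there because both factors are in L2.\<close>

lemma Delta_inner_tendsto:
  assumes s: "admissible s" and h: "admissible h" and b: "timing_bounds \<tau>s \<tau>h \<tau>c \<tau>n s h"
    and v: "v \<in> L2"
  shows "(\<lambda>n. LINT t:{0..<h n}|lebesgue. Delta s h v t * v t) \<longlonglongrightarrow> L2_inner (Delta s h v) v"
proof -
  have "\<exists>n. t < h n" for t
  proof (cases "0 \<le> t")
    case True
    then show ?thesis
      using admissible_ex_interval[OF h] by blast
  next
    case False
    then show ?thesis
      using h by (intro exI[of _ 0]) (simp add: admissible_def)
  qed
  then have U: "(\<Union>n. {0..<h n}) = {0..}"
    by auto
  have "incseq (\<lambda>n. {0..<h n})"
    using strict_mono_less_eq[OF admissible_strict_mono[OF h]] by (force simp: incseq_def)
  then have "(\<lambda>n. LINT t:{0..<h n}|lebesgue. Delta s h v t * v t)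
      \<longlonglongrightarrow> (LINT t:(\<Union>n. {0..<h n})|lebesgue. Delta s h v t * v t)"
    unfolding U[symmetric]
    by (rule set_integral_cont_up[rotated])
      (use L2_mult_set_integrable[OF Delta_L2[OF s h b v] v] U in auto)
  then show ?thesis
    by (simp add: L2_inner_def U)
qed

theorem lemma4:
  fixes \<tau>s \<tau>h \<tau>c \<tau>n :: real and s h :: "nat \<Rightarrow> real"
  assumes "\<tau>s \<in> {0<..}" and "\<tau>h \<in> {0<..}" and "\<tau>c \<in> {0..\<tau>h}" and "\<tau>n \<in> {0..min \<tau>c \<tau>s}"
    and "admissible s" and "admissible h"
    and "timing_bounds \<tau>s \<tau>h \<tau>c \<tau>n s h"
  shows "\<forall>v\<in>L2. Delta s h v \<in> L2 \<and>
           L2_inner (Delta s h v) v + \<tau>n / 2 * (L2_norm v)\<^sup>2 \<ge> 0"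
proof (intro ballI conjI)
  fix v assume v: "v \<in> L2"
  note asm = assms(5-7) v
  show "Delta s h v \<in> L2"
    by (rule Delta_L2[OF asm])
  have \<tau>n: "0 \<le> \<tau>n"
    using assms(4) by simp
  have "0 \<le> L2_inner v v"
    unfolding L2_inner_def set_lebesgue_integral_def by (intro integral_nonneg_AE) auto
  then have norm: "(L2_norm v)\<^sup>2 = (LINT x:{0..}|lebesgue. (v x)\<^sup>2)"
    by (simp add: L2_norm_def L2_inner_def power2_eq_square)
  \<comment> \<open>Dropping the retained square and extending the energy to the whole half-line
    gives a bound independent of \<open>n\<close>, which survives the limit.\<close>
  have "- (\<tau>n / 2 * (L2_norm v)\<^sup>2) \<le> (LINT t:{0..<h (Suc n)}|lebesgue. Delta s h v t * v t)" for n
  proof -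
    have "(LINT x:{0<..h n}|lebesgue. (v x)\<^sup>2) \<le> (LINT x:{0..}|lebesgue. (v x)\<^sup>2)"
      unfolding set_lebesgue_integral_def
      using L2_set_integrable_Ioc(2)[OF v order_refl] v
      by (intro integral_mono) (auto simp: set_integrable_def L2_def indicator_def)
    then have "\<tau>n / 2 * (LINT x:{0<..h n}|lebesgue. (v x)\<^sup>2) \<le> \<tau>n / 2 * (L2_norm v)\<^sup>2"
      unfolding norm using \<tau>n by (intro mult_left_mono) auto
    then show ?thesis
      using Delta_inner_lower_bound[OF asm \<tau>n, of n]
        zero_le_power2[of "LINT x:{s (last_event s (h n))<..h (Suc n)}|lebesgue. v x"]
      by linarith
  qed
  then have "- (\<tau>n / 2 * (L2_norm v)\<^sup>2) \<le> L2_inner (Delta s h v) v"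
    by (intro LIMSEQ_le_const[OF LIMSEQ_Suc[OF Delta_inner_tendsto[OF asm]]]) blast
  then show "0 \<le> L2_inner (Delta s h v) v + \<tau>n / 2 * (L2_norm v)\<^sup>2"
    by simp
qed

end
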